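(* Let $A\in\mathbb{C}^{3\times 3}$ have distinct eigenvalues $a,b,c\in\mathbb{C}$ which are not collinear (as points of the plane). Then there exists a polynomial $f$ in three variables such that the Kippenhahn curve $C(A)$ of $A$ satisfies $$f\big(r(a),r(b),r(c)\big)=0 .$$
   Context: For a point $z\in\mathbb{C}$ of the curve and $a\in\mathbb{C}$, $r(a):=|z-a|$ denotes the distance between $z$ and $a$; that the curve satisfies the equation means that the equation holds for every point $z$ of the curve. Write $\operatorname{Re}A=\frac{A+A^\star}{2}$, $\operatorname{Im}A=\frac{A-A^\star}{2i}$. The Kippenhahn curve $C(A)$ is the real affine part of the algebraic curve dual to the projective curve $\det(tI+u\operatorname{Re}A+v\operatorname{Im}A)=0$ in homogeneous coordinates $(t:u:v)$; here the line $\{t+ux+vy=0\}$ in the dual coordinates corresponds to the point $z=x+iy$. It is an algebraic curve, and the numerical range $W(A)=\{u^\star Au/u^\star u: u\in\mathbb{C}^3\setminus\{0\}\}$ is the convex hull of $C(A)$. *)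

theory Defs
  imports "HOL-Analysis.Analysis" "Jordan_Normal_Form.Schur_Decomposition"
begin

text \<open>Polynomials in three variables over a ring are the elements of the iterated polynomial ring
  \<open>R[X][Y][Z]\<close>, of type \<open>'a poly poly poly\<close>; the innermost variable is the first one.\<close>

definition Const3 :: "'a::zero \<Rightarrow> 'a poly poly poly" where
  "Const3 c = [:[:[:c:]:]:]"

definition X3 :: "'a::comm_semiring_1 poly poly poly" where
  "X3 = [:[:[:0, 1:]:]:]"

definition Y3 :: "'a::comm_semiring_1 poly poly poly" where
  "Y3 = [:[:0, 1:]:]"

definition Z3 :: "'a::comm_semiring_1 poly poly poly" where
  "Z3 = [:0, 1:]"

definition eval3 :: "'a::comm_semiring_1 poly poly poly \<Rightarrow> 'a \<Rightarrow> 'a \<Rightarrow> 'a \<Rightarrow> 'a" where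
  "eval3 f x y z = poly (poly (poly f [:[:z:]:]) [:y:]) x"

definition deriv_X3 :: "'a::idom poly poly poly \<Rightarrow> 'a poly poly poly" where
  "deriv_X3 = map_poly (map_poly pderiv)"

definition deriv_Y3 :: "'a::idom poly poly poly \<Rightarrow> 'a poly poly poly" where
  "deriv_Y3 = map_poly pderiv"

definition deriv_Z3 :: "'a::idom poly poly poly \<Rightarrow> 'a poly poly poly" where
  "deriv_Z3 = pderiv"

text \<open>Points of the complex projective plane and of its dual are represented by all their nonzero
  triples of homogeneous coordinates, so a projective set becomes a set of nonzero triples closed
  under nonzero scaling. The triple \<open>(l, m, n)\<close> stands for the line
  \<open>{l t + m u + n v = 0}\<close>.\<close>

definition tangent_lines :: "complex poly poly poly \<Rightarrow> (complex \<times> complex \<times> complex) set" where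
  "tangent_lines q = {(l, m, n). (l, m, n) \<noteq> (0, 0, 0) \<and>
     (\<exists>t u v c. (t, u, v) \<noteq> (0, 0, 0) \<and> eval3 q t u v = 0 \<and> c \<noteq> 0 \<and>
        l = c * eval3 (deriv_X3 q) t u v \<and>
        m = c * eval3 (deriv_Y3 q) t u v \<and>
        n = c * eval3 (deriv_Z3 q) t u v)}"

text \<open>Zariski closure in the projective plane. Since \<open>S\<close> is meant to be closed under nonzero
  scaling, a polynomial vanishes on \<open>S\<close> iff all its homogeneous components do, so testing with
  arbitrary instead of homogeneous polynomials gives the same set.\<close>

definition projective_closure ::
    "(complex \<times> complex \<times> complex) set \<Rightarrow> (complex \<times> complex \<times> complex) set" where
  "projective_closure S = {(l, m, n). (l, m, n) \<noteq> (0, 0, 0) \<and>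
     (\<forall>g. (\<forall>(l', m', n') \<in> S. eval3 g l' m' n' = 0) \<longrightarrow> eval3 g l m n = 0)}"

text \<open>The dual of the curve \<open>p = 0\<close>, for \<open>p\<close> homogeneous and nonzero, is the union of the duals of
  its irreducible components (the dual of a line being a point). Irreducible factors of \<open>p\<close> are
  again homogeneous. Passing to them is necessary: at a point of a repeated component the gradient
  of \<open>p\<close> itself vanishes.\<close>

definition dual_curve :: "complex poly poly poly \<Rightarrow> (complex \<times> complex \<times> complex) set" where
  "dual_curve p = (\<Union>q \<in> {q. irreducible q \<and> q dvd p}. projective_closure (tangent_lines q))"

definition mat_Re :: "complex mat \<Rightarrow> complex mat" where
  "mat_Re A = (1 / 2) \<cdot>\<^sub>m (A + mat_adjoint A)"

definition mat_Im :: "complex mat \<Rightarrow> complex mat" where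
  "mat_Im A = (1 / (2 * \<i>)) \<cdot>\<^sub>m (A - mat_adjoint A)"

definition kippenhahn_poly :: "complex mat \<Rightarrow> complex poly poly poly" where
  "kippenhahn_poly A = Determinant.det
     (X3 \<cdot>\<^sub>m 1\<^sub>m (dim_row A)
      + Y3 \<cdot>\<^sub>m map_mat Const3 (mat_Re A)
      + Z3 \<cdot>\<^sub>m map_mat Const3 (mat_Im A))"

definition kippenhahn_curve :: "complex mat \<Rightarrow> complex set" where
  "kippenhahn_curve A =
     {z. (1, complex_of_real (Re z), complex_of_real (Im z)) \<in> dual_curve (kippenhahn_poly A)}"

end

(* The numbers r(a)^2 - r(b)^2 and r(a)^2 - r(c)^2 are affine in Re z and Im z, and the pair of
   linear equations is regular because a, b, c are not collinear; so Re z and Im z are polynomials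
   in the distances and it suffices to find a nonzero polynomial vanishing on the dual curve.
   Let q be an irreducible factor of the determinantal cubic p. It is homogeneous, of degree k say,
   so the monomials of degree N in its partial derivatives are forms of degree N (k - 1). As p is
   monic in t, the restrictions of the forms of degree M to {p = 0} span a space of dimension at
   most 3 (M + 1), whereas the number of monomials grows quadratically in N. A linear relation
   between them is a homogeneous polynomial that vanishes on all tangent lines of q. *)
theory Submission
  imports Defs "HOL-Library.Function_Algebras" "HOL-Computational_Algebra.Field_as_Ring"
begin

section \<open>Evaluation of polynomials in three variables\<close>

lemma eval3_simps [simp]:
  "eval3 0 x y z = 0" "eval3 1 x y z = 1"
  "eval3 (f + g) x y z = eval3 f x y z + eval3 g x y z"
  "eval3 (f * g) x y z = eval3 f x y z * eval3 g x y z"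
  "eval3 (Const3 c) x y z = c"
  "eval3 X3 x y z = x" "eval3 Y3 x y z = y" "eval3 Z3 x y z = z"
  by (simp_all add: eval3_def Const3_def X3_def Y3_def Z3_def)

lemma eval3_diff [simp]:
  fixes f g :: "'a::comm_ring_1 poly poly poly"
  shows "eval3 (f - g) x y z = eval3 f x y z - eval3 g x y z"
  by (simp_all add: eval3_def)

lemma eval3_sum: "eval3 (sum F I) x y z = (\<Sum>i\<in>I. eval3 (F i) x y z)"
  by (simp add: eval3_def poly_sum)

lemma eval3_prod: "eval3 (prod F I) x y z = (\<Prod>i\<in>I. eval3 (F i) x y z)"
  by (simp add: eval3_def poly_prod)

lemma eval3_monom:
  "eval3 (monom (monom (monom c i) j) l) x y z = c * x ^ i * y ^ j * z ^ l"
  by (simp add: eval3_def poly_monom poly_const_pow algebra_simps)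

lemma comm_ring_hom_eval3: "comm_ring_hom (\<lambda>f::'a::comm_ring_1 poly poly poly. eval3 f x y z)"
  by unfold_locales simp_all

text \<open>Constants and variables generate the ring, as peeling off one coefficient layer at a
  time shows. This induction yields existence claims about polynomial functions without triple
  coefficient sums.\<close>

lemma poly3_induct [case_names Const X Y Z add mult]:
  fixes f :: "'a::comm_ring_1 poly poly poly"
  assumes Const: "\<And>c. P (Const3 c)" and X: "P X3" and Y: "P Y3" and Z: "P Z3"
    and add: "\<And>f g. P f \<Longrightarrow> P g \<Longrightarrow> P (f + g)"
    and mult: "\<And>f g. P f \<Longrightarrow> P g \<Longrightarrow> P (f * g)"
  shows "P f"
proof -
  have 0: "P 0" using Const[of 0] by (simp add: Const3_def)
  have 1: "P [:[:h:]:]" for h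
  proof (induction h)
    case (pCons c h)
    have "[:[:pCons c h:]:] = Const3 c + X3 * [:[:h:]:]"
      by (simp add: Const3_def X3_def)
    then show ?case using Const X add mult pCons by metis
  qed (use 0 in simp)
  have 2: "P [:g:]" for g
  proof (induction g)
    case (pCons h g)
    have "[:pCons h g:] = [:[:h:]:] + Y3 * [:g:]" by (simp add: Y3_def)
    then show ?case using 1 Y add mult pCons by metis
  qed (use 0 in simp)
  show ?thesis
  proof (induction f)
    case (pCons g f)
    have "pCons g f = [:g:] + Z3 * f" by (simp add: Z3_def)
    then show ?case using 2 Z add mult pCons by metis
  qed (use 0 in simp)
qed

lemma exists_eval3_subst:
  fixes f x' y' z' :: "'a::comm_ring_1 poly poly poly"
  shows "\<exists>g. \<forall>x y z. eval3 g x y z = eval3 f (eval3 x' x y z) (eval3 y' x y z) (eval3 z' x y z)"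
proof (induction f rule: poly3_induct)
  case (Const c) show ?case by (rule exI[of _ "Const3 c"]) simp
next
  case (add f g) then show ?case by (metis eval3_simps(3))
next
  case (mult f g) then show ?case by (metis eval3_simps(4))
qed auto

lemma exists_poly_eval3_ray:
  fixes f :: "'a::comm_ring_1 poly poly poly"
  shows "\<exists>P. \<forall>s. poly P s = eval3 f (s * x) (s * y) (s * z)"
proof (induction f rule: poly3_induct)
  case (Const c) show ?case by (rule exI[of _ "[:c:]"]) simp
next
  case X show ?case by (rule exI[of _ "[:0, x:]"]) simp
next
  case Y show ?case by (rule exI[of _ "[:0, y:]"]) simp
next
  case Z show ?case by (rule exI[of _ "[:0, z:]"]) simp
next
  case (add f g) then show ?case by (metis poly_add eval3_simps(3))
next
  case (mult f g) then show ?case by (metis poly_mult eval3_simps(4))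
qed

text \<open>The final equation must have real coefficients, whereas the polynomial vanishing on the
  dual curve is complex.\<close>

lemma exists_eval3_Re_Im:
  fixes f :: "complex poly poly poly"
  shows "\<exists>g h. \<forall>x y z. Re (eval3 f (of_real x) (of_real y) (of_real z)) = eval3 g x y z \<and>
     Im (eval3 f (of_real x) (of_real y) (of_real z)) = eval3 h x y z"
proof (induction f rule: poly3_induct)
  case (Const c) show ?case by (rule exI[of _ "Const3 (Re c)"], rule exI[of _ "Const3 (Im c)"]) simp
next
  case X show ?case by (rule exI[of _ X3], rule exI[of _ 0]) simp
next
  case Y show ?case by (rule exI[of _ Y3], rule exI[of _ 0]) simp
next
  case Z show ?case by (rule exI[of _ Z3], rule exI[of _ 0]) simp
next
  case (add f1 f2)
  then obtain g1 h1 g2 h2 where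
    "\<forall>x y z. Re (eval3 f1 (of_real x) (of_real y) (of_real z)) = eval3 g1 x y z \<and>
     Im (eval3 f1 (of_real x) (of_real y) (of_real z)) = eval3 h1 x y z"
    "\<forall>x y z. Re (eval3 f2 (of_real x) (of_real y) (of_real z)) = eval3 g2 x y z \<and>
     Im (eval3 f2 (of_real x) (of_real y) (of_real z)) = eval3 h2 x y z" by blast
  then show ?case by (intro exI[of _ "g1 + g2"] exI[of _ "h1 + h2"]) simp
next
  case (mult f1 f2)
  then obtain g1 h1 g2 h2 where
    "\<forall>x y z. Re (eval3 f1 (of_real x) (of_real y) (of_real z)) = eval3 g1 x y z \<and>
     Im (eval3 f1 (of_real x) (of_real y) (of_real z)) = eval3 h1 x y z"
    "\<forall>x y z. Re (eval3 f2 (of_real x) (of_real y) (of_real z)) = eval3 g2 x y z \<and>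
     Im (eval3 f2 (of_real x) (of_real y) (of_real z)) = eval3 h2 x y z" by blast
  then show ?case by (intro exI[of _ "g1 * g2 - h1 * h2"] exI[of _ "g1 * h2 + h1 * g2"]) simp
qed

lemma exists_eval3_nonzero:
  fixes f :: "'a::idom poly poly poly"
  assumes "f \<noteq> 0" "infinite S"
  shows "\<exists>x\<in>S. \<exists>y\<in>S. \<exists>z\<in>S. eval3 f x y z \<noteq> 0"
proof -
  \<comment> \<open>The map \<open>h\<close> embeds the scalars as constants into the coefficient
    ring of \<open>g\<close>. This allows the coordinates to be chosen one at a time, outermost
    variable first, each time avoiding finitely many roots.\<close>
  have nz: "\<exists>s\<in>S. poly g (h s) \<noteq> 0" if "g \<noteq> 0" "inj h" for g :: "'b::idom poly" and h
  proof (rule ccontr)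
    assume "\<not> ?thesis"
    then have "h ` S \<subseteq> {s. poly g s = 0}" by auto
    then have "finite (h ` S)" using poly_roots_finite[OF that(1)] finite_subset by blast
    then show False using assms(2) that(2) finite_imageD inj_on_subset by blast
  qed
  obtain z where z: "z \<in> S" "poly f [:[:z:]:] \<noteq> 0"
    using nz[OF assms(1), of "\<lambda>z. [:[:z:]:]"] by (auto simp: inj_def)
  obtain y where y: "y \<in> S" "poly (poly f [:[:z:]:]) [:y:] \<noteq> 0"
    using nz[OF z(2), of "\<lambda>z. [:z:]"] by (auto simp: inj_def)
  obtain x where x: "x \<in> S" "poly (poly (poly f [:[:z:]:]) [:y:]) x \<noteq> 0"
    using nz[OF y(2), of "\<lambda>z. z"] by (auto simp: inj_def)
  with y z show ?thesis unfolding eval3_def by blast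
qed

section \<open>Formal partial derivatives and tangent lines\<close>

lemma poly_map_poly_pderiv: "poly (map_poly pderiv g) [:y:] = pderiv (poly g [:y:])"
  for g :: "'a::idom poly poly"
  by (induction g) (auto simp: map_poly_pCons pderiv_add pderiv_smult pderiv_pCons)

text \<open>Differentiation in one variable commutes with substituting constants for the outer ones,
  so the rules for \<open>pderiv\<close> become available.\<close>

lemma eval3_deriv:
  shows eval3_deriv_X3: "eval3 (deriv_X3 f) x y z = poly (pderiv (poly (poly f [:[:z:]:]) [:y:])) x"
    and eval3_deriv_Y3: "eval3 (deriv_Y3 f) x y z = poly (poly (pderiv (poly f [:[:z:]:])) [:y:]) x"
proof -
  have "poly (map_poly (map_poly pderiv) f) [:[:z:]:] = map_poly pderiv (poly f [:[:z:]:])"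
  proof (induction f)
    case (pCons g f)
    have smult: "map_poly pderiv (Polynomial.smult [:z:] h) = Polynomial.smult [:z:] (map_poly pderiv h)" for h
      by (intro poly_eqI) (simp add: coeff_map_poly pderiv_smult)
    have add: "map_poly pderiv (h1 + h2) = map_poly pderiv h1 + map_poly pderiv h2"
      for h1 h2 :: "'a poly poly"
      by (intro poly_eqI) (simp add: coeff_map_poly pderiv_add)
    show ?case using pCons by (simp add: map_poly_pCons add smult)
  qed simp
  then show "eval3 (deriv_X3 f) x y z = poly (pderiv (poly (poly f [:[:z:]:]) [:y:])) x"
    by (simp add: eval3_def deriv_X3_def poly_map_poly_pderiv)
  have "poly (map_poly pderiv f) [:[:z:]:] = pderiv (poly f [:[:z:]:])"
    by (induction f) (auto simp: map_poly_pCons pderiv_add pderiv_smult pderiv_pCons)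
  then show "eval3 (deriv_Y3 f) x y z = poly (poly (pderiv (poly f [:[:z:]:])) [:y:]) x"
    by (simp add: eval3_def deriv_Y3_def)
qed

lemma eval3_deriv_mult:
  fixes f g :: "'a::idom poly poly poly"
  assumes "D = deriv_X3 \<or> D = deriv_Y3 \<or> D = deriv_Z3"
  shows "eval3 (D (f * g)) x y z = eval3 (D f) x y z * eval3 g x y z + eval3 f x y z * eval3 (D g) x y z"
  using assms
  by (auto simp: eval3_deriv pderiv_mult eval3_def[of "_ * _"] eval3_def[of f] eval3_def[of g] algebra_simps)
     (auto simp: eval3_def deriv_Z3_def pderiv_mult algebra_simps)

text \<open>At a zero of \<open>q\<close> the gradient of \<open>u * q\<close> is \<open>u\<close>
  times that of \<open>q\<close>, and a unit has no zeros, so its value is absorbed into the scaling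
  factor. Hence associated factors need not be treated separately, and finitely many irreducible
  factors suffice.\<close>

lemma tangent_lines_unit:
  assumes "u * w = 1"
  shows "tangent_lines (u * q) \<subseteq> tangent_lines q"
proof
  fix L assume "L \<in> tangent_lines (u * q)"
  then obtain l m n t x y c where L: "L = (l, m, n)" "L \<noteq> (0, 0, 0)"
    and h: "(t, x, y) \<noteq> (0, 0, 0)" "eval3 (u * q) t x y = 0" "c \<noteq> 0"
      "l = c * eval3 (deriv_X3 (u * q)) t x y"
      "m = c * eval3 (deriv_Y3 (u * q)) t x y"
      "n = c * eval3 (deriv_Z3 (u * q)) t x y"
    unfolding tangent_lines_def by auto
  have "eval3 (u * w) t x y = 1" using assms by simp
  then have nz: "eval3 u t x y \<noteq> 0" by auto
  then have "eval3 q t x y = 0" using h(2) by simp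
  moreover have "l = (c * eval3 u t x y) * eval3 (deriv_X3 q) t x y"
    "m = (c * eval3 u t x y) * eval3 (deriv_Y3 q) t x y"
    "n = (c * eval3 u t x y) * eval3 (deriv_Z3 q) t x y"
    using h calculation by (auto simp: eval3_deriv_mult)
  ultimately show "L \<in> tangent_lines q"
    using L h(1,3) nz unfolding tangent_lines_def mem_Collect_eq case_prod_conv L(1)
    by (intro conjI exI[of _ t] exI[of _ x] exI[of _ y] exI[of _ "c * eval3 u t x y"]) simp_all
qed

lemma projective_closure_subset: "S \<subseteq> T \<Longrightarrow> projective_closure S \<subseteq> projective_closure T"
  unfolding projective_closure_def by clarsimp blast

section \<open>Linear dependence by counting, and factors of monomials\<close>

text \<open>The family is indexed because different indices may give the same vector; such a
  repetition is itself a relation, with coefficients \<open>1\<close> and \<open>-1\<close>.\<close>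

lemma (in vector_space) dependent_family:
  assumes "finite I" "finite B" "card B < card I" "\<And>i. i \<in> I \<Longrightarrow> m i \<in> span B"
  shows "\<exists>c. (\<exists>i\<in>I. c i \<noteq> 0) \<and> (\<Sum>i\<in>I. scale (c i) (m i)) = 0"
proof (cases "inj_on m I")
  case True
  have "dependent (m ` I)"
  proof (rule ccontr)
    assume "\<not> ?thesis"
    then have "card (m ` I) \<le> card B"
      using independent_span_bound[OF assms(2)] assms(4) by blast
    then show False using assms(3) True by (simp add: card_image)
  qed
  then obtain d where d: "\<exists>v\<in>m ` I. d v \<noteq> 0" "(\<Sum>v\<in>m ` I. scale (d v) v) = 0"
    using assms(1) by (auto simp: dependent_finite)
  then show ?thesis using True
    by (intro exI[of _ "d \<circ> m"]) (auto simp: sum.reindex)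
next
  case False
  then obtain i j where ij: "i \<in> I" "j \<in> I" "i \<noteq> j" "m i = m j" by (auto simp: inj_on_def)
  define c where "c = (\<lambda>k. if k = i then 1 else if k = j then -1 else 0 :: 'a)"
  have "(\<Sum>k\<in>I. scale (c k) (m k)) = (\<Sum>k\<in>{i, j}. scale (c k) (m k))"
    using ij assms(1) by (intro sum.mono_neutral_right) (auto simp: c_def)
  also have "\<dots> = 0" using ij by (simp add: c_def)
  finally show ?thesis using ij by (intro exI[of _ c]) (auto simp: c_def)
qed


text \<open>The order at zero and the degree are both additive and both sum to \<open>n\<close>.
  Since the order never exceeds the degree, they agree in each factor.\<close>

lemma monom_factor:
  fixes P Q :: "'a::idom poly"
  assumes "P * Q = monom c n" "c \<noteq> 0"
  shows "\<exists>a k. k \<le> n \<and> P = monom a k"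
proof -
  have nz: "P * Q \<noteq> 0" using assms by simp
  have "Polynomial.order 0 P + Polynomial.order 0 Q = n"
    using order_mult[OF nz, of 0] assms by (simp add: order_0_monom)
  moreover have "degree P + degree Q = n"
    using nz assms degree_mult_eq[of P Q] degree_monom_eq[of c n] by (metis mult_eq_0_iff)
  moreover have "Polynomial.order 0 P \<le> degree P" "Polynomial.order 0 Q \<le> degree Q"
    using nz by (auto intro!: order_degree)
  ultimately have *: "Polynomial.order 0 P = degree P" "degree P \<le> n" by linarith+
  then have "monom 1 (degree P) dvd P" using nz by (subst monom_1_dvd_iff) auto
  then have "coeff P i = 0" if "i < degree P" for i using that by (simp add: monom_1_dvd_iff')
  then have "P = monom (lead_coeff P) (degree P)"
    by (intro poly_eqI) (metis coeff_monom coeff_eq_0 linorder_less_linear)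
  with * show ?thesis by blast
qed

section \<open>Forms as functions on triples\<close>

lemma sum_fun_apply: "sum F A v = (\<Sum>i\<in>A. F i v)"
  for F :: "'b \<Rightarrow> 'a \<Rightarrow> 'c::comm_monoid_add"
  by (induction A rule: infinite_finite_induct) auto

text \<open>Forms are treated as functions, so that their restrictions to a zero set live in the
  same vector space.\<close>

definition fun_scale :: "'b::times \<Rightarrow> ('a \<Rightarrow> 'b) \<Rightarrow> 'a \<Rightarrow> 'b" where
  "fun_scale c f = (\<lambda>x. c * f x)"

lemma fun_scale_apply [simp]: "fun_scale c f x = c * f x"
  by (simp add: fun_scale_def)

interpretation fun_space: vector_space "fun_scale :: complex \<Rightarrow> ('a \<Rightarrow> complex) \<Rightarrow> 'a \<Rightarrow> complex"
  by unfold_locales (auto simp: fun_eq_iff algebra_simps)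

definition mono3 :: "nat \<Rightarrow> nat \<Rightarrow> nat \<Rightarrow> complex \<times> complex \<times> complex \<Rightarrow> complex" where
  "mono3 i j l = (\<lambda>(x, y, z). x ^ i * y ^ j * z ^ l)"

definition forms3 :: "nat \<Rightarrow> (complex \<times> complex \<times> complex \<Rightarrow> complex) set" where
  "forms3 k = fun_space.span {mono3 i j l |i j l. i + j + l = k}"

lemma mono3_mult: "mono3 i j l * mono3 i' j' l' = mono3 (i + i') (j + j') (l + l')"
  by (auto simp: mono3_def power_add algebra_simps)

lemma mono3_in_forms3: "mono3 i j l \<in> forms3 (i + j + l)"
  unfolding forms3_def by (intro fun_space.span_base) blast

lemma fun_space_span_mult_left:
  assumes "f \<in> fun_space.span B" "\<And>b. b \<in> B \<Longrightarrow> g * b \<in> fun_space.span C"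
  shows "g * f \<in> fun_space.span C"
  using assms(1)
proof (induction rule: fun_space.span_induct_alt)
  case base
  have "g * 0 = 0" by (rule mult_zero_right)
  then show ?case by (metis fun_space.span_zero)
next
  case (step c b f)
  have "g * (fun_scale c b + f) = fun_scale c (g * b) + g * f"
    by (rule ext) (simp add: algebra_simps)
  then show ?case
    using step assms(2) by (simp only: fun_space.span_add fun_space.span_scale)
qed

lemma forms3_mult:
  assumes "f \<in> forms3 m" "g \<in> forms3 n"
  shows "f * g \<in> forms3 (m + n)"
proof -
  have 1: "mono3 i j l * g \<in> forms3 (i + j + l + n)" for i j l
    using assms(2) unfolding forms3_def
  proof (rule fun_space_span_mult_left)
    fix b assume "b \<in> {mono3 i j l |i j l. i + j + l = n}"
    then obtain i' j' l' where "b = mono3 i' j' l'" "i' + j' + l' = n" by blast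
    then show "mono3 i j l * b \<in> fun_space.span {mono3 i' j' l' |i' j' l'. i' + j' + l' = i + j + l + n}"
      by (intro fun_space.span_base CollectI exI[of _ "i + i'"] exI[of _ "j + j'"] exI[of _ "l + l'"])
         (simp add: mono3_mult)
  qed
  have "g * f \<in> forms3 (m + n)"
    using assms(1) unfolding forms3_def
  proof (rule fun_space_span_mult_left)
    fix b assume "b \<in> {mono3 i j l |i j l. i + j + l = m}"
    then obtain i j l where "b = mono3 i j l" "i + j + l = m" by blast
    then show "g * b \<in> fun_space.span {mono3 i' j' l' |i' j' l'. i' + j' + l' = m + n}"
      using 1[of i j l] by (simp only: mult.commute[of g] forms3_def)
  qed
  then show ?thesis by (simp only: mult.commute[of f])
qed

lemma forms3_power: "f \<in> forms3 m \<Longrightarrow> f ^ n \<in> forms3 (m * n)"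
proof (induction n)
  case 0
  have "mono3 0 0 0 = 1" by (auto simp: mono3_def)
  then show ?case using mono3_in_forms3[of 0 0 0] by (simp only: power_0 mult_0_right add_0_right)
next
  case (Suc n)
  then show ?case using forms3_mult[of f m "f ^ n" "m * n"] by (simp only: power_Suc mult_Suc_right)
qed

lemma forms3_scale:
  assumes "f \<in> forms3 k"
  shows "f (s * x, s * y, s * z) = s ^ k * f (x, y, z)"
  using assms unfolding forms3_def
proof (induction rule: fun_space.span_induct_alt)
  case (step c b f)
  then show ?case by (auto simp: mono3_def algebra_simps power_mult_distrib power_add)
qed auto

text \<open>\<open>P\<close> is a polynomial over the ring of functions whose coefficients are the
  homogeneous components of \<open>f\<close>. Evaluation at \<open>1\<close> adds them up, and the
  Cauchy product makes the grading multiplicative.\<close>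

lemma forms3_grading:
  "\<exists>P. (\<forall>n. coeff P n \<in> forms3 n) \<and> poly P 1 = (\<lambda>(x, y, z). eval3 f x y z)"
proof (induction f rule: poly3_induct)
  case (Const c)
  have "fun_scale c (mono3 0 0 0) \<in> forms3 0"
    using mono3_in_forms3[of 0 0 0] unfolding forms3_def by (auto intro: fun_space.span_scale)
  then show ?case
    by (intro exI[of _ "[:fun_scale c (mono3 0 0 0):]"])
       (auto simp: coeff_pCons mono3_def fun_eq_iff forms3_def fun_space.span_zero split: nat.split)
next
  case X
  show ?case using mono3_in_forms3[of 1 0 0]
    by (intro exI[of _ "[:0, mono3 1 0 0:]"])
       (auto simp: coeff_pCons mono3_def fun_eq_iff forms3_def fun_space.span_zero split: nat.split)
next
  case Y
  show ?case using mono3_in_forms3[of 0 1 0]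
    by (intro exI[of _ "[:0, mono3 0 1 0:]"])
       (auto simp: coeff_pCons mono3_def fun_eq_iff forms3_def fun_space.span_zero split: nat.split)
next
  case Z
  show ?case using mono3_in_forms3[of 0 0 1]
    by (intro exI[of _ "[:0, mono3 0 0 1:]"])
       (auto simp: coeff_pCons mono3_def fun_eq_iff forms3_def fun_space.span_zero split: nat.split)
next
  case (add f g)
  then obtain P Q where "\<forall>n. coeff P n \<in> forms3 n" "poly P 1 = (\<lambda>(x, y, z). eval3 f x y z)"
    "\<forall>n. coeff Q n \<in> forms3 n" "poly Q 1 = (\<lambda>(x, y, z). eval3 g x y z)" by blast
  note PQ = this
  have "coeff (P + Q) n \<in> forms3 n" for n
    unfolding coeff_add forms3_def using PQ(1,3) unfolding forms3_def
    by (intro fun_space.span_add) blast+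
  moreover have "poly (P + Q) 1 = (\<lambda>(x, y, z). eval3 (f + g) x y z)"
    unfolding poly_add PQ by (rule ext) auto
  ultimately show ?case by blast
next
  case (mult f g)
  then obtain P Q where PQ: "\<And>n. coeff P n \<in> forms3 n" "poly P 1 = (\<lambda>(x, y, z). eval3 f x y z)"
    "\<And>n. coeff Q n \<in> forms3 n" "poly Q 1 = (\<lambda>(x, y, z). eval3 g x y z)" by blast
  have "coeff P i * coeff Q (n - i) \<in> forms3 n" if "i \<le> n" for i n
    using forms3_mult[OF PQ(1)[of i] PQ(3)[of "n - i"]] that by (simp only: le_add_diff_inverse)
  then have "coeff (P * Q) n \<in> forms3 n" for n
    unfolding coeff_mult forms3_def by (intro fun_space.span_sum) (simp only: atMost_iff)
  moreover have "poly (P * Q) 1 = (\<lambda>(x, y, z). eval3 (f * g) x y z)"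
    unfolding poly_mult PQ by (rule ext) auto
  ultimately show ?case by blast
qed

text \<open>Scaling by \<open>2\<close> alone detects the degree, because it multiplies the
  component of degree \<open>n\<close> by \<open>2 ^ n\<close> and these powers are
  distinct.\<close>

lemma forms3_of_homogeneous:
  assumes "\<And>x y z. eval3 f (2 * x) (2 * y) (2 * z) = 2 ^ k * eval3 f x y z"
  shows "(\<lambda>(x, y, z). eval3 f x y z) \<in> forms3 k"
proof -
  obtain P where P: "\<And>n. coeff P n \<in> forms3 n" "poly P 1 = (\<lambda>(x, y, z). eval3 f x y z)"
    using forms3_grading by blast
  have "eval3 f x y z = coeff P k (x, y, z)" for x y z
  proof -
    \<comment> \<open>This is the restriction of \<open>f\<close> to the ray through
      \<open>(x, y, z)\<close>; its coefficients are the values of the components at that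
      point.\<close>
    define p where "p = (\<Sum>n\<le>degree P. monom (coeff P n (x, y, z)) n)"
    have cp: "coeff p n = coeff P n (x, y, z)" for n
      by (auto simp: p_def coeff_sum if_distrib sum.delta coeff_eq_0 cong: if_cong)
    have pp: "poly p s = eval3 f (s * x) (s * y) (s * z)" for s
    proof -
      have "eval3 f (s * x) (s * y) (s * z) = poly P 1 (s * x, s * y, s * z)" by (simp add: P)
      also have "\<dots> = (\<Sum>n\<le>degree P. coeff P n (s * x, s * y, s * z))"
        by (simp add: poly_altdef sum_fun_apply)
      also have "\<dots> = poly p s"
        by (simp add: p_def poly_sum poly_monom forms3_scale[OF P(1)] mult.commute)
      finally show ?thesis by simp
    qed
    have "pcompose p [:0, 2:] = Polynomial.smult (2 ^ k) p"
      using assms[of "s * x" "s * y" "s * z" for s]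
      by (intro iffD1[OF poly_eq_poly_eq_iff]) (auto simp: fun_eq_iff poly_pcompose pp algebra_simps)
    then have "2 ^ n * coeff p n = 2 ^ k * coeff p n" for n
      by (metis coeff_pcompose_linear coeff_smult)
    then have 0: "coeff p n = 0" if "n \<noteq> k" for n
      using that by (metis mult_cancel_right of_nat_numeral of_nat_power of_nat_eq_iff power_inject_exp one_less_numeral_iff semiring_norm(76))
    have "p = monom (coeff p k) k" using 0 by (intro poly_eqI) auto
    then have "poly p 1 = coeff p k" by (metis poly_monom power_one mult.right_neutral)
    then show ?thesis using pp[of 1] cp by simp
  qed
  then have "(\<lambda>(x, y, z). eval3 f x y z) = coeff P k" by auto
  with P show ?thesis by simp
qed


lemma forms3_monic_split:
  assumes "f \<in> forms3 k"
  shows "\<exists>a. f - fun_scale a (mono3 k 0 0) \<in> fun_space.span {mono3 i j l |i j l. i + j + l = k \<and> i < k}"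
proof -
  have "{mono3 i j l |i j l. i + j + l = k} \<subseteq>
      insert (mono3 k 0 0) {mono3 i j l |i j l. i + j + l = k \<and> i < k}"
  proof
    fix m assume "m \<in> {mono3 i j l |i j l. i + j + l = k}"
    then obtain i j l where m: "m = mono3 i j l" "i + j + l = k" by blast
    show "m \<in> insert (mono3 k 0 0) {mono3 i j l |i j l. i + j + l = k \<and> i < k}"
    proof (cases "i < k")
      case False
      then have "i = k" "j = 0" "l = 0" using m(2) by auto
      then show ?thesis using m by blast
    qed (use m in blast)
  qed
  then have "f \<in> fun_space.span (insert (mono3 k 0 0) {mono3 i j l |i j l. i + j + l = k \<and> i < k})"
    using assms fun_space.span_mono unfolding forms3_def by blast
  then show ?thesis unfolding fun_space.span_breakdown_eq .
qed

section \<open>Forms restricted to a plane cubic\<close>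

lemma fun_space_span_mult_right:
  assumes "f \<in> fun_space.span B" "\<And>b. b \<in> B \<Longrightarrow> b * g \<in> fun_space.span C"
  shows "f * g \<in> fun_space.span C"
  using fun_space_span_mult_left[OF assms(1), of g C] assms(2) by (simp only: mult.commute[of g])

text \<open>Multiplication by \<open>V\<close> is restriction to the zero set of \<open>p\<close>.\<close>

lemma forms3_reduce:
  assumes p: "p \<in> forms3 3" "p (1, 0, 0) = 1" and f: "f \<in> forms3 k"
  defines "V \<equiv> (\<lambda>x. if p x = 0 then 1 else 0 :: complex)"
  shows "f * V \<in> fun_space.span ((\<lambda>(i, j). mono3 i j (k - i - j) * V) ` ({..<3} \<times> {..k}))"
    (is "_ \<in> fun_space.span ?B")
proof -
  obtain a where a: "p - fun_scale a (mono3 3 0 0) \<in>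
      fun_space.span {mono3 i j l |i j l. i + j + l = 3 \<and> i < 3}"
    using forms3_monic_split[OF p(1)] by auto
  \<comment> \<open>Each of these monomials contains the second or third variable. Hence
    \<open>a\<close>, the coefficient of the cube of the first variable in \<open>p\<close>, equals
    \<open>p (1, 0, 0)\<close>.\<close>
  have "h (1, 0, 0) = 0" if "h \<in> fun_space.span {mono3 i j l |i j l. i + j + l = 3 \<and> i < 3}" for h
    using that
  proof (induction rule: fun_space.span_induct_alt)
    case (step c b h)
    then obtain i j l where "b = mono3 i j l" "i + j + l = 3" "i < 3" by auto
    then have "b (1, 0, 0) = 0" by (cases "j = 0") (auto simp: mono3_def power_0_left)
    then show ?case using step by simp
  qed simp
  from this[OF a] have "a = 1" using p(2) by (simp add: mono3_def)
  \<comment> \<open>On the zero set of \<open>p\<close> the cube of the first variable equals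
    \<open>r\<close>, where that variable has exponent at most two. Substituting \<open>r\<close>
    lowers the exponent \<open>i\<close> and drives the induction below.\<close>
  define r where "r = mono3 3 0 0 - p"
  have "r = - (p - fun_scale a (mono3 3 0 0))" by (simp add: r_def \<open>a = 1\<close> fun_eq_iff)
  then have r: "r \<in> fun_space.span {mono3 i j l |i j l. i + j + l = 3 \<and> i < 3}"
    using fun_space.span_neg[OF a] by simp
  have mono: "mono3 i j l * V \<in> fun_space.span ?B" if "i + j + l = k" for i j l
    using that
  proof (induction i arbitrary: j l rule: less_induct)
    case (less i)
    show ?case
    proof (cases "i < 3")
      case True
      then have "mono3 i j l * V \<in> ?B" using less.prems
        by (intro image_eqI[of _ _ "(i, j)"]) auto
      then show ?thesis by (rule fun_space.span_base)
    next
      case False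
      have "mono3 i j l = mono3 (i - 3) j l * mono3 3 0 0"
        using False by (simp only: mono3_mult) simp
      then have "mono3 i j l * V = mono3 (i - 3) j l * (mono3 3 0 0 * V)"
        by (simp only: mult.assoc)
      also have "mono3 3 0 0 * V = r * V" by (auto simp: r_def V_def fun_eq_iff)
      also have "mono3 (i - 3) j l * (r * V) = (mono3 (i - 3) j l * V) * r"
        by (simp only: mult_ac)
      finally have eq: "mono3 i j l * V = (mono3 (i - 3) j l * V) * r" .
      show ?thesis unfolding eq using r
      proof (rule fun_space_span_mult_left)
        fix b assume "b \<in> {mono3 i j l |i j l. i + j + l = 3 \<and> i < 3}"
        then obtain i' j' l' where b: "b = mono3 i' j' l'" "i' + j' + l' = 3" "i' < 3" by blast
        have "mono3 (i - 3) j l * V * b = mono3 (i - 3 + i') (j + j') (l + l') * V"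
          unfolding b mono3_mult[symmetric] by (simp only: mult_ac)
        moreover have "mono3 (i - 3 + i') (j + j') (l + l') * V \<in> fun_space.span ?B"
          by (rule less.IH) (use less.prems False b in auto)
        ultimately show "mono3 (i - 3) j l * V * b \<in> fun_space.span ?B" by (simp only:)
      qed
    qed
  qed
  show ?thesis
    using f unfolding forms3_def by (rule fun_space_span_mult_right) (use mono in blast)
qed

text \<open>The \<open>(n + 1)^2\<close> products have degree \<open>2 * m * n\<close>, so their
  restrictions to the zero set of \<open>p\<close> lie in a space spanned by
  \<open>3 * (2 * m * n + 1)\<close> functions. For large \<open>n\<close> they are linearly
  dependent.\<close>

lemma exists_vanishing_form:
  assumes p: "p \<in> forms3 3" "p (1, 0, 0) = 1"
    and F: "F1 \<in> forms3 m" "F2 \<in> forms3 m" "F3 \<in> forms3 m"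
  shows "\<exists>n c. (\<exists>j\<le>n. \<exists>l\<le>n. c j l \<noteq> 0) \<and>
    (\<forall>x. p x = 0 \<longrightarrow> (\<Sum>j\<le>n. \<Sum>l\<le>n. c j l * F1 x ^ (2 * n - j - l) * F2 x ^ j * F3 x ^ l) = 0)"
proof -
  define V where "V = (\<lambda>x. if p x = 0 then 1 else 0 :: complex)"
  \<comment> \<open>With this choice \<open>(n + 1)^2 = 6 * m * n + 5 * n + 1\<close>, which exceeds
    \<open>6 * m * n + 3\<close>.\<close>
  define n where "n = 6 * m + 3"
  define k where "k = m * (2 * n)"
  \<comment> \<open>The exponents of \<open>F2\<close> and \<open>F3\<close> fill a square; the
    total exponent \<open>2 * n\<close> leaves a nonnegative one for \<open>F1\<close>.\<close>
  define I where "I = {..n} \<times> {..n}"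
  define B where "B = (\<lambda>(i, j). mono3 i j (k - i - j) * V) ` ({..<3} \<times> {..k})"
  define M where "M = (\<lambda>(j, l). F1 ^ (2 * n - j - l) * F2 ^ j * F3 ^ l * V)"
  have "M i \<in> fun_space.span B" if i: "i \<in> I" for i
  proof -
    obtain j l where jl: "i = (j, l)" "j \<le> n" "l \<le> n" using i unfolding I_def by auto
    have "F1 ^ (2 * n - j - l) * F2 ^ j * F3 ^ l \<in> forms3 (m * (2 * n - j - l) + m * j + m * l)"
      by (intro forms3_mult forms3_power F)
    also have "m * (2 * n - j - l) + m * j + m * l = m * ((2 * n - j - l) + j + l)"
      by (simp only: distrib_left)
    also have "(2 * n - j - l) + j + l = 2 * n" using jl by simp
    finally have "F1 ^ (2 * n - j - l) * F2 ^ j * F3 ^ l * V \<in> fun_space.span B"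
      unfolding B_def V_def k_def by (rule forms3_reduce[OF p])
    then show ?thesis unfolding M_def jl case_prod_conv .
  qed
  moreover have "card B < card I"
  proof -
    have "card B \<le> card ({..<3::nat} \<times> {..k})" unfolding B_def by (rule card_image_le) simp
    also have "\<dots> = 3 * (k + 1)" by simp
    also have "\<dots> < (n + 1) * (n + 1)" by (simp add: k_def n_def algebra_simps)
    finally show ?thesis by (simp add: I_def)
  qed
  ultimately obtain c where c: "\<exists>i\<in>I. c i \<noteq> 0" "(\<Sum>i\<in>I. fun_scale (c i) (M i)) = 0"
    using fun_space.dependent_family[of I B M] by (auto simp: I_def B_def)
  have pow_app: "(f ^ i) v = f v ^ i" for f :: "'a \<Rightarrow> complex" and i v
    by (induction i) auto
  have "(\<Sum>j\<le>n. \<Sum>l\<le>n. c (j, l) * F1 x ^ (2 * n - j - l) * F2 x ^ j * F3 x ^ l) = 0"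
    if "p x = 0" for x
  proof -
    have "0 = (\<Sum>i\<in>I. fun_scale (c i) (M i)) x" using c(2) by simp
    also have "\<dots> = (\<Sum>(j, l)\<in>I. c (j, l) * F1 x ^ (2 * n - j - l) * F2 x ^ j * F3 x ^ l)"
      unfolding sum_fun_apply by (intro sum.cong) (auto simp: M_def pow_app V_def that)
    also have "\<dots> = (\<Sum>j\<le>n. \<Sum>l\<le>n. c (j, l) * F1 x ^ (2 * n - j - l) * F2 x ^ j * F3 x ^ l)"
      unfolding I_def by (rule sum.cartesian_product[symmetric])
    finally show ?thesis by simp
  qed
  then show ?thesis using c(1)
    by (intro exI[of _ n] exI[of _ "\<lambda>j l. c (j, l)"]) (auto simp: I_def)
qed


section \<open>Derivatives and factors of forms\<close>

lemma map_poly_const: "f 0 = 0 \<Longrightarrow> map_poly f [:c:] = [:f c:]"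
  by (cases "c = 0") (simp_all add: map_poly_pCons)

lemma deriv_generators:
  fixes c :: "'a::idom"
  shows "deriv_X3 (Const3 c) = 0" "deriv_X3 (X3 :: 'a poly poly poly) = 1"
    "deriv_X3 (Y3 :: 'a poly poly poly) = 0" "deriv_X3 (Z3 :: 'a poly poly poly) = 0"
    "deriv_Y3 (Const3 c) = 0" "deriv_Y3 (X3 :: 'a poly poly poly) = 0"
    "deriv_Y3 (Y3 :: 'a poly poly poly) = 1" "deriv_Y3 (Z3 :: 'a poly poly poly) = 0"
    "deriv_Z3 (Const3 c) = 0" "deriv_Z3 (X3 :: 'a poly poly poly) = 0"
    "deriv_Z3 (Y3 :: 'a poly poly poly) = 0" "deriv_Z3 (Z3 :: 'a poly poly poly) = 1"
  by (simp_all add: deriv_X3_def deriv_Y3_def deriv_Z3_def Const3_def X3_def Y3_def Z3_def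
      map_poly_const map_poly_pCons pderiv_pCons one_pCons)

lemma eval3_deriv_add:
  fixes f g :: "'a::idom poly poly poly"
  assumes "D = deriv_X3 \<or> D = deriv_Y3 \<or> D = deriv_Z3"
  shows "eval3 (D (f + g)) x y z = eval3 (D f) x y z + eval3 (D g) x y z"
proof -
  have "poly (f + g) [:[:z:]:] = poly f [:[:z:]:] + poly g [:[:z:]:]" by simp
  then show ?thesis using assms
    by (elim disjE) (simp_all only: eval3_deriv poly_add pderiv_add, simp add: eval3_def deriv_Z3_def pderiv_add)
qed

text \<open>Identifying formal with analytic derivatives gives access to the chain rule and to
  uniqueness of derivatives.\<close>

lemma DERIV_eval3:
  fixes f :: "complex poly poly poly"
  shows DERIV_eval3_X: "((\<lambda>x. eval3 f x y z) has_field_derivative eval3 (deriv_X3 f) x y z) (at x)"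
    and DERIV_eval3_Y: "((\<lambda>y. eval3 f x y z) has_field_derivative eval3 (deriv_Y3 f) x y z) (at y)"
    and DERIV_eval3_Z: "((\<lambda>z. eval3 f x y z) has_field_derivative eval3 (deriv_Z3 f) x y z) (at z)"
proof -
  have eta: "eval3 (Const3 c) x y = (\<lambda>_. c)" "eval3 X3 x y = (\<lambda>_. x)" "eval3 Y3 x y = (\<lambda>_. y)"
    "eval3 Z3 x y = (\<lambda>z. z)" "eval3 (f + g) x y = (\<lambda>z. eval3 f x y z + eval3 g x y z)"
    "eval3 (f * g) x y = (\<lambda>z. eval3 f x y z * eval3 g x y z)"
    for c x y :: complex and f g
    by (simp_all add: fun_eq_iff)
  show "((\<lambda>x. eval3 f x y z) has_field_derivative eval3 (deriv_X3 f) x y z) (at x)"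
    "((\<lambda>y. eval3 f x y z) has_field_derivative eval3 (deriv_Y3 f) x y z) (at y)"
    "((\<lambda>z. eval3 f x y z) has_field_derivative eval3 (deriv_Z3 f) x y z) (at z)"
    by (induction f rule: poly3_induct)
       (auto simp: eta deriv_generators eval3_deriv_add eval3_deriv_mult intro!: derivative_eq_intros)
qed

text \<open>Differentiating \<open>f(2x, 2y, 2z) = 2^k f(x, y, z)\<close> on both sides yields a
  factor \<open>2\<close> on the left, which is then cancelled.\<close>

lemma deriv_forms3:
  fixes f :: "complex poly poly poly"
  assumes f: "(\<lambda>(x, y, z). eval3 f x y z) \<in> forms3 k"
    and D: "D = deriv_X3 \<or> D = deriv_Y3 \<or> D = deriv_Z3"
  shows "(\<lambda>(x, y, z). eval3 (D f) x y z) \<in> forms3 (k - 1)"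
proof (rule forms3_of_homogeneous)
  fix x y z
  have hom: "eval3 f (s * x) (s * y) (s * z) = s ^ k * eval3 f x y z" for s x y z
    using forms3_scale[OF f, of s x y z] by simp
  have twice: "((*) 2 has_field_derivative 2) (at w)" for w :: complex
    using DERIV_cmult[OF DERIV_ident, of 2 w UNIV] by simp
  have "eval3 (D f) (2 * x) (2 * y) (2 * z) * 2 = 2 ^ k * eval3 (D f) x y z"
    using D
  proof (elim disjE)
    assume "D = deriv_X3"
    have "((\<lambda>x. eval3 f (2 * x) (2 * y) (2 * z)) has_field_derivative
        eval3 (deriv_X3 f) (2 * x) (2 * y) (2 * z) * 2) (at x)"
      by (rule DERIV_chain2[OF DERIV_eval3_X twice])
    moreover have "((\<lambda>x. eval3 f (2 * x) (2 * y) (2 * z)) has_field_derivative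
        2 ^ k * eval3 (deriv_X3 f) x y z) (at x)"
      unfolding hom by (intro DERIV_cmult DERIV_eval3_X)
    ultimately show ?thesis unfolding \<open>D = deriv_X3\<close> by (rule DERIV_unique)
  next
    assume "D = deriv_Y3"
    have "((\<lambda>y. eval3 f (2 * x) (2 * y) (2 * z)) has_field_derivative
        eval3 (deriv_Y3 f) (2 * x) (2 * y) (2 * z) * 2) (at y)"
      by (rule DERIV_chain2[OF DERIV_eval3_Y twice])
    moreover have "((\<lambda>y. eval3 f (2 * x) (2 * y) (2 * z)) has_field_derivative
        2 ^ k * eval3 (deriv_Y3 f) x y z) (at y)"
      unfolding hom by (intro DERIV_cmult DERIV_eval3_Y)
    ultimately show ?thesis unfolding \<open>D = deriv_Y3\<close> by (rule DERIV_unique)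
  next
    assume "D = deriv_Z3"
    have "((\<lambda>z. eval3 f (2 * x) (2 * y) (2 * z)) has_field_derivative
        eval3 (deriv_Z3 f) (2 * x) (2 * y) (2 * z) * 2) (at z)"
      by (rule DERIV_chain2[OF DERIV_eval3_Z twice])
    moreover have "((\<lambda>z. eval3 f (2 * x) (2 * y) (2 * z)) has_field_derivative
        2 ^ k * eval3 (deriv_Z3 f) x y z) (at z)"
      unfolding hom by (intro DERIV_cmult DERIV_eval3_Z)
    ultimately show ?thesis unfolding \<open>D = deriv_Z3\<close> by (rule DERIV_unique)
  qed
  \<comment> \<open>For \<open>k = 0\<close> the truncated \<open>k - 1\<close> is \<open>0\<close>,
    so cancelling the factor \<open>2\<close> is not enough. Scaling by \<open>0\<close>, with
    \<open>0 ^ 0 = 1\<close>, shows that \<open>f\<close> is constant, so its derivatives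
    vanish.\<close>
  moreover have "eval3 (D f) u v w = 0" if "k = 0" for u v w
  proof -
    have const: "eval3 f u v w = eval3 f 0 0 0" for u v w
      using hom[of 0 u v w] that by simp
    have "((\<lambda>t. eval3 f t v w) has_field_derivative 0) (at u)"
      "((\<lambda>t. eval3 f u t w) has_field_derivative 0) (at v)"
      "((\<lambda>t. eval3 f u v t) has_field_derivative 0) (at w)"
      unfolding const[of _ v w] const[of u _ w] const[of u v] by (rule DERIV_const)+
    with D show ?thesis
      using DERIV_unique[OF DERIV_eval3_X] DERIV_unique[OF DERIV_eval3_Y] DERIV_unique[OF DERIV_eval3_Z]
      by blast
  qed
  ultimately show "eval3 (D f) (2 * x) (2 * y) (2 * z) = 2 ^ (k - 1) * eval3 (D f) x y z"
    by (cases k) auto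
qed

text \<open>On a ray through the origin \<open>p\<close> is a monomial, hence so is its divisor \<open>q\<close>. Its exponent may
  depend on the ray, but one of the finitely many polynomials \<open>q(2x) - 2\<^sup>k q(x)\<close> is zero
  because their product vanishes wherever \<open>p\<close> does not.\<close>

lemma eval3_factor_homogeneous:
  assumes p: "p = q * r" "p \<noteq> 0" "(\<lambda>(x, y, z). eval3 p x y z) \<in> forms3 n"
  shows "\<exists>k\<le>n. (\<lambda>(x, y, z). eval3 q x y z) \<in> forms3 k"
proof -
  obtain q2 where q2: "\<And>x y z. eval3 q2 x y z = eval3 q (2 * x) (2 * y) (2 * z)"
    using exists_eval3_subst[of q "Const3 2 * X3" "Const3 2 * Y3" "Const3 2 * Z3"] by auto
  define h where "h = (\<Prod>k\<le>n. q2 - Const3 (2 ^ k) * q)"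
  have "eval3 (h * p) x y z = 0" for x y z
  proof (cases "eval3 p x y z = 0")
    case False
    obtain P where P: "\<And>s. poly P s = eval3 q (s * x) (s * y) (s * z)"
      using exists_poly_eval3_ray by metis
    obtain R where R: "\<And>s. poly R s = eval3 r (s * x) (s * y) (s * z)"
      using exists_poly_eval3_ray by metis
    have "poly (P * R) s = poly (monom (eval3 p x y z) n) s" for s
      using forms3_scale[OF p(3), of s x y z] unfolding p(1) by (simp add: P R poly_monom mult.commute)
    then have "P * R = monom (eval3 p x y z) n" by (intro iffD1[OF poly_eq_poly_eq_iff]) auto
    then obtain a k where k: "k \<le> n" "P = monom a k" using monom_factor False by blast
    \<comment> \<open>The values of the monomial \<open>P\<close> at \<open>1\<close> and
      \<open>2\<close> differ by the factor \<open>2 ^ k\<close>.\<close>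
    then have "eval3 q2 x y z = 2 ^ k * eval3 q x y z"
      using P[of 1] P[of 2] by (simp add: q2 poly_monom mult.commute)
    then show ?thesis using k(1) by (auto simp: h_def eval3_prod)
  qed simp
  then have "h * p = 0" using exists_eval3_nonzero[of "h * p" UNIV] by (auto simp: infinite_UNIV_char_0)
  then have "h = 0" using p(2) by simp
  then obtain k where k: "k \<le> n" "q2 = Const3 (2 ^ k) * q" by (auto simp: h_def)
  then have "(\<lambda>(x, y, z). eval3 q x y z) \<in> forms3 k"
    by (intro forms3_of_homogeneous) (simp flip: q2)
  with k(1) show ?thesis by blast
qed

section \<open>Polynomials vanishing on the dual curve\<close>

text \<open>A relation between the partial derivatives of \<open>q\<close> on the zero set of
  \<open>p\<close> is a form \<open>g\<close> vanishing on the tangent lines. \<open>G\<close> is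
  its dehomogenisation, suited to dual points with first coordinate \<open>1\<close>.\<close>

lemma tangent_lines_vanishing:
  fixes p q :: "complex poly poly poly"
  assumes p: "(\<lambda>(x, y, z). eval3 p x y z) \<in> forms3 3" "eval3 p 1 0 0 = 1" and q: "q dvd p"
  shows "\<exists>g G. G \<noteq> 0 \<and> (\<forall>x y z. eval3 G x y z = eval3 g 1 y z) \<and>
    (\<forall>(l, m, n) \<in> tangent_lines q. eval3 g l m n = 0)"
proof -
  obtain r where r: "p = q * r" using q by (elim dvdE)
  have "p \<noteq> 0" using p(2) by auto
  then obtain k where "(\<lambda>(x, y, z). eval3 q x y z) \<in> forms3 k"
    using eval3_factor_homogeneous[OF r _ p(1)] by blast
  note F = deriv_forms3[OF this]
  obtain n c where nz: "\<exists>j\<le>n. \<exists>l\<le>n. c j l \<noteq> 0"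
    and c: "\<And>x y z. eval3 p x y z = 0 \<Longrightarrow>
      (\<Sum>j\<le>n. \<Sum>l\<le>n. c j l * eval3 (deriv_X3 q) x y z ^ (2 * n - j - l) *
        eval3 (deriv_Y3 q) x y z ^ j * eval3 (deriv_Z3 q) x y z ^ l) = 0"
    using exists_vanishing_form[OF p(1) _ F[of deriv_X3] F[of deriv_Y3] F[of deriv_Z3]] p(2) by auto
  define g where "g = (\<Sum>j\<le>n. \<Sum>l\<le>n. monom (monom (monom (c j l) (2 * n - j - l)) j) l)"
  define G where "G = (\<Sum>j\<le>n. \<Sum>l\<le>n. monom (monom (monom (c j l) 0) j) l)"
  obtain j l where jl: "j \<le> n" "l \<le> n" "c j l \<noteq> 0" using nz by blast
  \<comment> \<open>All terms of \<open>g\<close> have degree \<open>2 * n\<close>, so distinct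
    terms remain distinct monomials once the first variable is dropped, and no coefficient is
    lost.\<close>
  have "coeff (coeff (coeff G l) j) 0 = (\<Sum>j'\<le>n. \<Sum>l'\<le>n. if j' = j \<and> l' = l then c j l else 0)"
    unfolding G_def coeff_sum by (intro sum.cong) auto
  also have "\<dots> = (\<Sum>j'\<le>n. if j' = j then c j l else 0)"
    using jl by (intro sum.cong) (auto simp: sum.delta)
  also have "\<dots> = c j l" using jl by simp
  finally have "G \<noteq> 0" using jl by auto
  moreover have "eval3 G x y z = eval3 g 1 y z" for x y z
    by (simp add: G_def g_def eval3_sum eval3_monom)
  moreover have "eval3 g l m n' = 0" if "(l, m, n') \<in> tangent_lines q" for l m n'
  proof -
    obtain t u v s where h: "eval3 q t u v = 0"
      "l = s * eval3 (deriv_X3 q) t u v" "m = s * eval3 (deriv_Y3 q) t u v"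
      "n' = s * eval3 (deriv_Z3 q) t u v"
      using \<open>(l, m, n') \<in> tangent_lines q\<close> unfolding tangent_lines_def by auto
    \<comment> \<open>The line is \<open>s\<close> times the gradient, and \<open>g\<close> is
      homogeneous of degree \<open>2 * n\<close>. The remaining sum vanishes since \<open>q\<close>
      divides \<open>p\<close>, so the point of tangency is a zero of \<open>p\<close>.\<close>
    have "eval3 g l m n' = (\<Sum>j\<le>n. \<Sum>i\<le>n. s ^ (2 * n) * (c j i * eval3 (deriv_X3 q) t u v ^ (2 * n - j - i) *
        eval3 (deriv_Y3 q) t u v ^ j * eval3 (deriv_Z3 q) t u v ^ i))"
      unfolding g_def eval3_sum eval3_monom
    proof (intro sum.cong refl)
      fix j i assume "j \<in> {..n}" "i \<in> {..n}"
      then have "s ^ (2 * n) = s ^ (2 * n - j - i) * s ^ j * s ^ i"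
        by (simp flip: power_add)
      then show "c j i * l ^ (2 * n - j - i) * m ^ j * n' ^ i = s ^ (2 * n) *
          (c j i * eval3 (deriv_X3 q) t u v ^ (2 * n - j - i) *
           eval3 (deriv_Y3 q) t u v ^ j * eval3 (deriv_Z3 q) t u v ^ i)"
        by (simp add: h power_mult_distrib)
    qed
    also have "\<dots> = 0" using c[of t u v] h(1) by (simp add: r flip: sum_distrib_left)
    finally show ?thesis .
  qed
  ultimately show ?thesis by blast
qed

text \<open>Up to units \<open>p\<close> has finitely many irreducible factors, so the product of
  their polynomials works. Vanishing passes from tangent lines to the closure by the definition of
  the latter.\<close>

lemma dual_curve_vanishing:
  fixes p :: "complex poly poly poly"
  assumes p: "(\<lambda>(x, y, z). eval3 p x y z) \<in> forms3 3" "eval3 p 1 0 0 = 1"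
  shows "\<exists>G. G \<noteq> 0 \<and> (\<forall>x y z. (1, y, z) \<in> dual_curve p \<longrightarrow> eval3 G x y z = 0)"
proof -
  have "p \<noteq> 0" using p(2) by auto
  define vanishing where "vanishing q g G \<longleftrightarrow> G \<noteq> 0 \<and>
    (\<forall>x y z. eval3 G x y z = eval3 g 1 y z) \<and> (\<forall>(l, m, n) \<in> tangent_lines q. eval3 g l m n = 0)"
    for q g G :: "complex poly poly poly"
  have "\<exists>g G. vanishing q g G" if "q \<in> prime_factors p" for q
    unfolding vanishing_def
    by (rule tangent_lines_vanishing[OF p]) (use that in \<open>rule in_prime_factors_imp_dvd\<close>)
  then obtain g G where "\<And>q. q \<in> prime_factors p \<Longrightarrow> vanishing q (g q) (G q)" by metis
  then have gG: "\<And>q. q \<in> prime_factors p \<Longrightarrow> G q \<noteq> 0"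
      "\<And>q x y z. q \<in> prime_factors p \<Longrightarrow> eval3 (G q) x y z = eval3 (g q) 1 y z"
      "\<And>q l m n. q \<in> prime_factors p \<Longrightarrow> (l, m, n) \<in> tangent_lines q \<Longrightarrow> eval3 (g q) l m n = 0"
    unfolding vanishing_def by blast+
  have "eval3 (prod G (prime_factors p)) x y z = 0" if yz: "(1, y, z) \<in> dual_curve p" for x y z
  proof -
    obtain q where q: "irreducible q" "q dvd p" "(1, y, z) \<in> projective_closure (tangent_lines q)"
      using yz unfolding dual_curve_def by blast
    define q' where "q' = normalize q"
    have "q' \<in> prime_factors p"
      using q \<open>p \<noteq> 0\<close> by (simp add: prime_factors_dvd q'_def prime_def irreducible_imp_prime_elem)
    have "unit_factor q * q' = q" unfolding q'_def by (rule unit_factor_mult_normalize)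
    moreover have "q \<noteq> 0" using q(2) \<open>p \<noteq> 0\<close> by auto
    then obtain w where "unit_factor q * w = 1"
      using unit_factor_is_unit[of q] by (metis dvdE)
    ultimately have "tangent_lines q \<subseteq> tangent_lines q'" using tangent_lines_unit by metis
    then have "(1, y, z) \<in> projective_closure (tangent_lines q')"
      using q(3) projective_closure_subset by blast
    then have "eval3 (g q') 1 y z = 0"
      using gG(3)[OF \<open>q' \<in> prime_factors p\<close>] unfolding projective_closure_def by auto
    then show ?thesis
      using \<open>q' \<in> prime_factors p\<close> gG(2) by (auto simp: eval3_prod)
  qed
  moreover have "prod G (prime_factors p) \<noteq> 0" using gG(1) by simp
  ultimately show ?thesis by blast
qed

section \<open>The Kippenhahn cubic\<close>

text \<open>Evaluation is a ring homomorphism and so commutes with the determinant. The evaluated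
  matrix is linear in \<open>(x, y, z)\<close> and is the identity at
  \<open>(1, 0, 0)\<close>.\<close>

lemma kippenhahn_poly_props:
  assumes A: "A \<in> carrier_mat 3 3"
  shows "(\<lambda>(x, y, z). eval3 (kippenhahn_poly A) x y z) \<in> forms3 3"
    and "eval3 (kippenhahn_poly A) 1 0 0 = 1"
proof -
  define M where "M x y z = x \<cdot>\<^sub>m 1\<^sub>m 3 + y \<cdot>\<^sub>m mat_Re A + z \<cdot>\<^sub>m mat_Im A" for x y z
  have dims: "dim_row A = 3" "dim_col A = 3" using A by auto
  have Re: "mat_Re A \<in> carrier_mat 3 3" and Im: "mat_Im A \<in> carrier_mat 3 3"
    using dims by (auto simp: mat_Re_def mat_Im_def mat_adjoint_def)
  have ev: "eval3 (kippenhahn_poly A) x y z = Determinant.det (M x y z)" for x y z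
  proof -
    interpret ev: comm_ring_hom "\<lambda>f. eval3 f x y z" by (rule comm_ring_hom_eval3)
    have "eval3 (kippenhahn_poly A) x y z = Determinant.det (map_mat (\<lambda>f. eval3 f x y z)
       (X3 \<cdot>\<^sub>m 1\<^sub>m 3 + Y3 \<cdot>\<^sub>m map_mat Const3 (mat_Re A) + Z3 \<cdot>\<^sub>m map_mat Const3 (mat_Im A)))"
      unfolding kippenhahn_poly_def dims by (rule ev.hom_det[symmetric])
    also have "map_mat (\<lambda>f. eval3 f x y z)
       (X3 \<cdot>\<^sub>m 1\<^sub>m 3 + Y3 \<cdot>\<^sub>m map_mat Const3 (mat_Re A) + Z3 \<cdot>\<^sub>m map_mat Const3 (mat_Im A)) = M x y z"
      using Re Im by (intro eq_matI) (auto simp: M_def)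
    finally show ?thesis .
  qed
  have "M (2 * x) (2 * y) (2 * z) = 2 \<cdot>\<^sub>m M x y z" for x y z
    using Re Im by (intro eq_matI) (auto simp: M_def algebra_simps)
  moreover have "dim_col (M x y z) = 3" for x y z using Im by (simp add: M_def)
  ultimately show "(\<lambda>(x, y, z). eval3 (kippenhahn_poly A) x y z) \<in> forms3 3"
    by (intro forms3_of_homogeneous) (simp add: ev)
  have "M 1 0 0 = 1\<^sub>m 3" using Re Im by (intro eq_matI) (auto simp: M_def)
  then show "eval3 (kippenhahn_poly A) 1 0 0 = 1" by (simp add: ev)
qed

section \<open>Recovering a point of the plane from its distances\<close>

lemma exists_coordinates_of_distances:
  fixes a b c :: complex
  assumes "\<not> collinear {a, b, c}"
  shows "\<exists>g h :: real poly poly poly. \<forall>z.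
    eval3 g (cmod (z - a)) (cmod (z - b)) (cmod (z - c)) = Re z \<and>
    eval3 h (cmod (z - a)) (cmod (z - b)) (cmod (z - c)) = Im z"
proof -
  define u where "u = b - a"
  define v where "v = c - a"
  define D where "D = Re u * Im v - Im u * Re v"
  have "D \<noteq> 0"
  proof
    assume "D = 0"
    have "collinear {0, u, v}"
    proof (cases "u = 0")
      case False
      \<comment> \<open>If \<open>D\<close> vanishes then \<open>v / u\<close> is real, which makes
        \<open>0\<close>, \<open>u\<close>, \<open>v\<close> collinear.\<close>
      have "Im (v / u) = D / (cmod u)\<^sup>2"
        by (simp add: D_def Im_divide cmod_power2 algebra_simps)
      then have "v / u \<in> \<real>" using \<open>D = 0\<close> by (simp add: complex_is_Real_iff)
      then show ?thesis by (simp add: collinear_iff_Reals)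
    qed (simp add: collinear_2)
    then have "collinear {b, a, c}" 
      by (subst collinear_3) (simp_all add: NO_MATCH_def u_def v_def)
    then show False using assms by (simp add: insert_commute)
  qed
  define kb kc where "kb = (cmod b)\<^sup>2 - (cmod a)\<^sup>2" and "kc = (cmod c)\<^sup>2 - (cmod a)\<^sup>2"
  \<comment> \<open>At the distances of \<open>z\<close> these take the values
    \<open>2 (Re u Re z + Im u Im z)\<close> and \<open>2 (Re v Re z + Im v Im z)\<close>. Cramer's
    rule with determinant \<open>D\<close> then gives \<open>g\<close> and \<open>h\<close>.\<close>
  define eb ec :: "real poly poly poly"
    where "eb = X3 * X3 - Y3 * Y3 + Const3 kb" and "ec = X3 * X3 - Z3 * Z3 + Const3 kc"
  define g where "g = Const3 (1 / (2 * D)) * (Const3 (Im v) * eb - Const3 (Im u) * ec)"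
  define h where "h = Const3 (1 / (2 * D)) * (Const3 (Re u) * ec - Const3 (Re v) * eb)"
  have sq: "cmod w * cmod w = (Re w)\<^sup>2 + (Im w)\<^sup>2" "(cmod w)\<^sup>2 = (Re w)\<^sup>2 + (Im w)\<^sup>2" for w
    by (simp_all add: cmod_power2 flip: power2_eq_square)
  have "eval3 g (cmod (z - a)) (cmod (z - b)) (cmod (z - c)) = Re z \<and>
    eval3 h (cmod (z - a)) (cmod (z - b)) (cmod (z - c)) = Im z" for z
  proof -
    have "eval3 eb (cmod (z - a)) (cmod (z - b)) (cmod (z - c)) = 2 * (Re u * Re z + Im u * Im z)"
      "eval3 ec (cmod (z - a)) (cmod (z - b)) (cmod (z - c)) = 2 * (Re v * Re z + Im v * Im z)"
      by (simp_all add: eb_def ec_def kb_def kc_def u_def v_def sq)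
         (simp_all add: power2_eq_square algebra_simps)
    then show ?thesis using \<open>D \<noteq> 0\<close>
      by (simp add: g_def h_def field_simps) (simp add: D_def algebra_simps)
  qed
  then show ?thesis by blast
qed

text \<open>Merely asking for a nonzero \<open>f\<close> would be too weak: the distances of a plane
  point from three fixed points satisfy a polynomial relation, so a nonzero polynomial can vanish
  for every \<open>z\<close>. Hence \<open>f\<close> has to be nonzero at the distances of some
  \<open>z\<close>.\<close>

theorem proposition3:
  fixes A :: "complex mat" and a b c :: complex
  assumes "A \<in> carrier_mat 3 3"
    and "eigenvalue A a" and "eigenvalue A b" and "eigenvalue A c"
    and "a \<noteq> b" and "a \<noteq> c" and "b \<noteq> c"
    and "\<not> collinear {a, b, c}"
  shows "\<exists>f :: real poly poly poly.
           (\<exists>z. eval3 f (cmod (z - a)) (cmod (z - b)) (cmod (z - c)) \<noteq> 0) \<and>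
           (\<forall>z \<in> kippenhahn_curve A.
              eval3 f (cmod (z - a)) (cmod (z - b)) (cmod (z - c)) = 0)"
proof -
  note A = kippenhahn_poly_props[OF assms(1)]
  obtain G where G: "G \<noteq> 0"
    "\<And>x y z. (1, y, z) \<in> dual_curve (kippenhahn_poly A) \<Longrightarrow> eval3 G x y z = 0"
    using dual_curve_vanishing[OF A] by blast
  obtain g1 g2 :: "real poly poly poly" where g12:
    "\<And>x y z. Re (eval3 G (of_real x) (of_real y) (of_real z)) = eval3 g1 x y z"
    "\<And>x y z. Im (eval3 G (of_real x) (of_real y) (of_real z)) = eval3 g2 x y z"
    using exists_eval3_Re_Im[of G] by blast
  have "infinite (\<real> :: complex set)"
    unfolding Reals_def using finite_imageD[OF _ inj_of_real] infinite_UNIV_char_0 by blast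
  \<comment> \<open>Real coordinates are required because \<open>x\<close> and \<open>y\<close>
    become the real and imaginary part of the point where \<open>f\<close> does not vanish.\<close>
  then obtain w x y :: real where "eval3 G (of_real w) (of_real x) (of_real y) \<noteq> 0"
    using exists_eval3_nonzero[OF G(1)] by (metis Reals_cases)
  then have "eval3 g1 w x y \<noteq> 0 \<or> eval3 g2 w x y \<noteq> 0"
    using g12[of w x y] by (auto simp: complex_eq_iff)
  then obtain g where g: "eval3 g w x y \<noteq> 0" "g = g1 \<or> g = g2" by blast
  obtain hx hy :: "real poly poly poly" where h:
    "\<And>z. eval3 hx (cmod (z - a)) (cmod (z - b)) (cmod (z - c)) = Re z"
    "\<And>z. eval3 hy (cmod (z - a)) (cmod (z - b)) (cmod (z - c)) = Im z"
    using exists_coordinates_of_distances[OF assms(8)] by blast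
  \<comment> \<open>The first argument of \<open>G\<close> is arbitrary on the dual curve, so it may
    be frozen at \<open>w\<close>, a value for which \<open>g\<close> is not identically zero in the
    other two.\<close>
  obtain f where "\<And>x y z. eval3 f x y z =
      eval3 g (eval3 (Const3 w) x y z) (eval3 hx x y z) (eval3 hy x y z)"
    using exists_eval3_subst by blast
  then have f: "eval3 f (cmod (z - a)) (cmod (z - b)) (cmod (z - c)) = eval3 g w (Re z) (Im z)" for z
    by (simp add: h)
  have "eval3 g w (Re z) (Im z) = 0" if "z \<in> kippenhahn_curve A" for z
    using G(2)[of "Re z" "Im z" w] that g(2) g12[of w "Re z" "Im z"]
    unfolding kippenhahn_curve_def by auto
  with f g(1) show ?thesis
    by (intro exI[of _ f] conjI exI[of _ "Complex x y"]) auto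
qed

end
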